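(* Let $n \geq 4$. There exists a positive integral point $x = (x_1,\ldots,x_n; y_1,\ldots,y_n) \in Y_{D_n}(\mathbb{N})$ such that $$x_3 = F_n F_{n+1} - 1.$$ Moreover, $x_3$ is the largest coordinate of the point $x$ (among all the coordinates $x_1,\ldots,x_n,y_1,\ldots,y_n$).
   Context: $(F_k)_{k\ge 0}$ is the Fibonacci sequence: $F_0 = 0$, $F_1 = 1$, $F_{k+1} = F_k + F_{k-1}$. $\mathbb{N}$ denotes the set of positive integers. For $n \ge 4$, $Y_{D_n} \subset \mathbb{A}^{2n}$ is the affine variety in coordinates $(x_1,\ldots,x_n;y_1,\ldots,y_n)$ defined by the equations $$x_1 y_1 = x_3 + 1,$$ $$x_2 y_2 = x_3 + 1,$$ $$x_3 y_3 = x_1 x_2 + x_4,$$ $$x_i y_i = x_{i-1} + x_{i+1} \quad (4 \leq i \leq n-1),$$ $$x_n y_n = x_{n-1} + 1.$$ A positive integral point of $Y_{D_n}$, i.e. an element of $Y_{D_n}(\mathbb{N})$, is a solution in which every coordinate $x_i$ and $y_i$ is a positive integer. *)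

theory Defs
  imports "HOL-Number_Theory.Fib" "HOL-Library.FuncSet"
begin

text \<open>
  A point of affine \<open>2n\<close>-space is a pair \<open>(x, y)\<close> of coordinate families indexed by \<open>{1..n}\<close>;
  the families are extensional, i.e. \<open>undefined\<close> outside \<open>{1..n}\<close>, so that equality of points is
  equality of coordinates. The definition is meant for \<open>n \<ge> 4\<close>.
\<close>

definition Y_D :: "nat \<Rightarrow> ((nat \<Rightarrow> 'a::comm_ring_1) \<times> (nat \<Rightarrow> 'a)) set" where
  "Y_D n = {(x, y).
      x \<in> {1..n} \<rightarrow>\<^sub>E UNIV \<and> y \<in> {1..n} \<rightarrow>\<^sub>E UNIV \<and>
      x 1 * y 1 = x 3 + 1 \<and>
      x 2 * y 2 = x 3 + 1 \<and>
      x 3 * y 3 = x 1 * x 2 + x 4 \<and>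
      (\<forall>i\<in>{4..n - 1}. x i * y i = x (i - 1) + x (i + 1)) \<and>
      x n * y n = x (n - 1) + 1}"

definition Y_D_pos :: "nat \<Rightarrow> ((nat \<Rightarrow> int) \<times> (nat \<Rightarrow> int)) set" where
  "Y_D_pos n = {(x, y) \<in> Y_D n. \<forall>i\<in>{1..n}. x i > 0 \<and> y i > 0}"

end

theory Submission
  imports Defs
begin

text \<open>
  A solution is built with \<open>y 3 = 1\<close> and \<open>x 1 = x 2 = F\<^sub>n\<close>. Then \<open>x 3 = F\<^sub>n F\<^sub>n\<^sub>+\<^sub>1 - 1\<close> solves the first two
  equations with \<open>y 1 = y 2 = F\<^sub>n\<^sub>+\<^sub>1\<close>, and the third one becomes \<open>x 4 = F\<^sub>n\<^sub>-\<^sub>1 F\<^sub>n - 1\<close>. What is left is a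
  chain \<open>x 3, x 4, \<dots>, x n, 1\<close> with two prescribed initial values, in which every interior term
  divides the sum of its two neighbours.

  Read from its end, with the virtual terms \<open>1\<close> and \<open>0\<close> in front, the chain satisfies a recurrence
  \<open>z (t + 1) + z (t - 1) = y z t\<close>. If the multiplier \<open>y\<close> were always \<open>3\<close>, this would give \<open>z t = F\<^sub>2\<^sub>t\<close>,
  hence \<open>x 3 = F\<^sub>2\<^sub>n\<^sub>-\<^sub>2 = F\<^sub>n\<^sup>2 - F\<^sub>n\<^sub>-\<^sub>2\<^sup>2\<close>, which is too small. Raising the multiplier from \<open>3\<close> to \<open>5\<close> at
  a single place \<open>t = j\<close> adds \<open>2 F\<^sub>2\<^sub>j F\<^sub>2\<^sub>(\<^sub>t\<^sub>-\<^sub>j\<^sub>)\<close> to the later terms, by linearity of the recurrence.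
  For \<open>j = \<lfloor>(n - 1) / 2\<rfloor>\<close> the doubling formula for Fibonacci numbers and Cassini's identity show that
  the last two terms are exactly the prescribed ones (\<open>fib_chain_even\<close>, \<open>fib_chain_odd\<close>). For \<open>n = 4\<close>
  the place \<open>j = 1\<close> is that of the virtual term \<open>1\<close>, so only multipliers \<open>3\<close> occur.

  The chain increases towards \<open>x 3\<close>, the multipliers are at most \<open>5\<close>, and \<open>F\<^sub>n, F\<^sub>n\<^sub>+\<^sub>1\<close> are less than
  their product, so \<open>x 3\<close> is the largest coordinate.
\<close>

text \<open>Truncated subtraction makes the correction vanish for \<open>t \<le> j\<close>, so one formula covers both sides
  of the place where the multiplier is raised.\<close>

definition fib_chain :: "nat \<Rightarrow> nat \<Rightarrow> int" where
  "fib_chain j t = int (fib (2 * t)) + 2 * int (fib (2 * j)) * int (fib (2 * (t - j)))"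

lemma fib_even_step: "fib (2 * (t + 2)) + fib (2 * t) = 3 * fib (2 * (t + 1))"
  by (simp add: numeral_eq_Suc)

lemma fib_chain_step:
  "fib_chain j (t + 2) + fib_chain j t = (if t + 1 = j then 5 else 3) * fib_chain j (t + 1)"
proof -
  have *: "int (fib (2 * (s + 2))) + int (fib (2 * s)) = 3 * int (fib (2 * (s + 1)))" for s
    using fib_even_step[of s] by linarith
  consider "t + 2 \<le> j" | "t + 1 = j" | s where "t = j + s"
    using le_Suc_ex[of j t] by (cases "j \<le> t") (blast, linarith)
  then show ?thesis
  proof cases
    case 1
    then show ?thesis using *[of t] by (simp add: fib_chain_def)
  next
    case 2
    have "t + 2 - j = 1" "t - j = 0" "t + 1 - j = 0" using 2 by auto
    moreover have "fib (2 * 1) = 1" "fib (2 * 0) = 0" by (simp_all add: numeral_2_eq_2)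
    ultimately show ?thesis
      using *[of t] unfolding fib_chain_def 2[symmetric] by simp
  next
    case 3
    have "t + 2 - j = s + 2" "t - j = s" "t + 1 - j = s + 1" using 3 by auto
    then have "fib_chain j (t + 2) + fib_chain j t
        = (int (fib (2 * (t + 2))) + int (fib (2 * t)))
          + 2 * int (fib (2 * j)) * (int (fib (2 * (s + 2))) + int (fib (2 * s)))"
      unfolding fib_chain_def by (simp only: distrib_left)
    also have "\<dots> = 3 * fib_chain j (t + 1)"
      unfolding * fib_chain_def using \<open>t + 1 - j = s + 1\<close> by (simp only: distrib_left mult_ac)
    finally show ?thesis using 3 by simp
  qed
qed

lemma fib_chain_mono: "s \<le> t \<Longrightarrow> fib_chain j s \<le> fib_chain j t"
  unfolding fib_chain_def
  by (intro add_mono mult_left_mono) (auto intro!: fib_mono)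

lemma fib_chain_1: "1 \<le> j \<Longrightarrow> fib_chain j 1 = 1"
  by (simp add: fib_chain_def numeral_2_eq_2)

lemma fib_double:
  "int (fib (2 * m)) = int (fib m) * (2 * int (fib (Suc m)) - int (fib m))"
proof (cases m)
  case (Suc k)
  have "fib (2 * m) = fib (Suc (k + m))" using Suc by (simp add: mult_2)
  also have "\<dots> = fib (Suc m) * fib m + fib m * fib k"
    unfolding fib_add using Suc by simp
  finally show ?thesis using Suc by (simp add: algebra_simps)
qed simp

text \<open>Cassini's identity at an even index, as a quadratic relation between two consecutive values:
  all values in the next two lemmas are polynomials in these two.\<close>

lemma fib_Cassini_even:
  "int (fib (2 * j + 1)) ^ 2 = int (fib (2 * j)) * int (fib (2 * j + 1)) + int (fib (2 * j)) ^ 2 + 1"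
  using fib_Cassini_int[of "2 * j"] by (simp add: power2_eq_square algebra_simps)

lemma fib_chain_even:
  "fib_chain j (2 * j) = int (fib (2 * j + 1)) * int (fib (2 * j + 2)) - 1"
proof -
  have "2 * j - j = j" by simp
  then show ?thesis
    using fib_Cassini_even[of j] fib_double[of "2 * j"]
    by (simp add: fib_chain_def power2_eq_square algebra_simps)
qed

text \<open>The correction \<open>2 F\<^sub>2\<^sub>j F\<^sub>2\<^sub>(\<^sub>t\<^sub>-\<^sub>j\<^sub>)\<close> is symmetric under \<open>j \<mapsto> t - j\<close>, so for odd \<open>t\<close> the two middle
  positions give the same value. Both occur: the first one in \<open>x 3\<close> for even \<open>n\<close>, the second one in
  \<open>x 4\<close> for odd \<open>n\<close>.\<close>

lemma fib_chain_odd: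
  "fib_chain j (2 * j + 1) = int (fib (2 * j + 2)) * int (fib (2 * j + 3)) - 1"
    "fib_chain (j + 1) (2 * j + 1) = int (fib (2 * j + 2)) * int (fib (2 * j + 3)) - 1"
proof -
  have "2 * j + 1 - j = j + 1" "2 * j + 1 - (j + 1) = j" by auto
  moreover have "int (fib (2 * (2 * j + 1))) + 2 * int (fib (2 * j)) * int (fib (2 * (j + 1)))
      = int (fib (2 * j + 2)) * int (fib (2 * j + 3)) - 1"
    using fib_Cassini_even[of j] fib_double[of "2 * j + 1"]
    by (simp add: numeral_3_eq_3 power2_eq_square algebra_simps)
  ultimately show
    "fib_chain j (2 * j + 1) = int (fib (2 * j + 2)) * int (fib (2 * j + 3)) - 1"
    "fib_chain (j + 1) (2 * j + 1) = int (fib (2 * j + 2)) * int (fib (2 * j + 3)) - 1"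
    unfolding fib_chain_def by (simp_all only: mult_ac)
qed

text \<open>The values of \<open>x 3\<close> and \<open>x 4\<close> that the first three equations give for \<open>x 1 = x 2 = F\<^sub>n\<close>,
  \<open>y 1 = y 2 = F\<^sub>n\<^sub>+\<^sub>1\<close> and \<open>y 3 = 1\<close>.\<close>

lemma fib_chain_ends:
  assumes "n \<ge> 3" and j: "j = (n - 1) div 2"
  shows "fib_chain j (n - 1) = int (fib n) * int (fib (n + 1)) - 1"
    and "fib_chain j (n - 2) = int (fib (n - 1)) * int (fib n) - 1"
proof -
  have "fib_chain j (n - 1) = int (fib n) * int (fib (n + 1)) - 1 \<and>
        fib_chain j (n - 2) = int (fib (n - 1)) * int (fib n) - 1"
  proof (cases "even n")
    case True
    then have "n = 2 * j + 2" using assms by presburger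
    then show ?thesis
      using fib_chain_even[of j] fib_chain_odd(1)[of j] by (simp add: numeral_3_eq_3)
  next
    case False
    define k where "k = (n - 3) div 2"
    have "n = 2 * k + 3" "j = k + 1"
      using False assms unfolding k_def by presburger+
    then show ?thesis
      using fib_chain_even[of j] fib_chain_odd(2)[of k] by (simp add: numeral_3_eq_3)
  qed
  then show "fib_chain j (n - 1) = int (fib n) * int (fib (n + 1)) - 1"
    and "fib_chain j (n - 2) = int (fib (n - 1)) * int (fib n) - 1" by auto
qed

theorem theorem4p3:
  fixes n :: nat
  assumes "n \<ge> 4"
  shows "\<exists>x y. (x, y) \<in> Y_D_pos n \<and>
           x 3 = int (fib n) * int (fib (n + 1)) - 1 \<and>
           x 3 = Max (x ` {1..n} \<union> y ` {1..n})"
proof -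
  define j where "j = (n - 1) div 2"
  have "1 \<le> j" using assms by (simp add: j_def)
  define a b where "a = int (fib n)" and "b = int (fib (n + 1))"
  have "fib 4 \<le> fib n" and "fib 5 \<le> fib (n + 1)"
    using assms by (auto intro!: fib_mono)
  then have ab: "a \<ge> 3" "b \<ge> 5" by (simp_all add: a_def b_def eval_nat_numeral)
  define x where "x = restrict (\<lambda>i. if i \<le> 2 then a else fib_chain j (n + 2 - i)) {1..n}"
  define y where "y = restrict (\<lambda>i. if i \<le> 2 then b else if i = 3 then 1
                                    else if n + 2 - i = j then 5 else 3) {1..n}"
  have x12: "x 1 = a" "x 2 = a" and y123: "y 1 = b" "y 2 = b" "y 3 = 1"
    using assms by (auto simp: x_def y_def)
  have x_chain: "x i = fib_chain j (n + 2 - i)" if "3 \<le> i" "i \<le> n" for i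
    using that by (simp add: x_def)
  have y_chain: "y i = (if n + 2 - i = j then 5 else 3)" if "4 \<le> i" "i \<le> n" for i
    using that by (simp add: y_def)
  have x3: "x 3 = a * b - 1"
    using x_chain[of 3] fib_chain_ends(1)[of n j] assms by (simp add: j_def a_def b_def)
  have "n = Suc (Suc (n - 2))" using assms by simp
  then have "b = a + int (fib (n - 1))"
    unfolding a_def b_def
    by (metis Suc_eq_plus1 diff_Suc_1 fib.simps(3) of_nat_add)
  then have x4: "x 3 = a * a + x 4"
    using x_chain[of 4] fib_chain_ends(2)[of n j] assms x3
    by (simp add: j_def a_def algebra_simps)
  have step: "x i * y i = fib_chain j (n + 2 - (i - 1)) + fib_chain j (n + 2 - (i + 1))"
    if "4 \<le> i" "i \<le> n" for i
  proof -
    define t where "t = n + 1 - i"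
    have "n + 2 - i = t + 1" "n + 2 - (i - 1) = t + 2" "n + 2 - (i + 1) = t"
      using that by (auto simp: t_def)
    then show ?thesis
      using fib_chain_step[of j t] x_chain[of i] y_chain[of i] that by (simp add: mult.commute)
  qed
  have inner: "x i * y i = x (i - 1) + x (i + 1)" if "i \<in> {4..n - 1}" for i
    using step[of i] that x_chain[of "i - 1"] x_chain[of "i + 1"] by auto
  have last: "x n * y n = x (n - 1) + 1"
    using step[of n] assms x_chain[of "n - 1"] fib_chain_1[OF \<open>1 \<le> j\<close>] by simp
  have "(x, y) \<in> Y_D n"
    unfolding Y_D_def using x12 y123 x3 x4 inner last by (auto simp: x_def y_def)
  moreover have x_pos: "x i > 0" if "i \<in> {1..n}" for i
  proof (cases "i \<le> 2")
    case False
    then have "fib_chain j 1 \<le> x i"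
      using that x_chain[of i] fib_chain_mono[of 1 "n + 2 - i" j] by auto
    then show ?thesis using fib_chain_1[OF \<open>1 \<le> j\<close>] by simp
  qed (use that ab in \<open>auto simp: x_def\<close>)
  moreover have "y i > 0" if "i \<in> {1..n}" for i
    using that ab by (auto simp: y_def)
  ultimately have point: "(x, y) \<in> Y_D_pos n"
    by (simp add: Y_D_pos_def)
  have big: "a \<le> x 3" "b \<le> x 3" "5 \<le> x 3"
    using mult_right_mono[OF ab(1), of b] mult_left_mono[OF ab(2), of a] ab x3 by linarith+
  have "x i \<le> x 3" if "i \<in> {1..n}" for i
  proof (cases "i \<le> 2")
    case False
    then show ?thesis
      using that x_chain[of i] x_chain[of 3] assms fib_chain_mono[of "n + 2 - i" "n + 2 - 3" j]
      by auto
  qed (use that big in \<open>auto simp: x_def\<close>)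
  moreover have "y i \<le> x 3" if "i \<in> {1..n}" for i
    using that big by (auto simp: y_def)
  ultimately have "x 3 = Max (x ` {1..n} \<union> y ` {1..n})"
    using assms by (intro Max_eqI[symmetric]) auto
  then show ?thesis using point x3 unfolding a_def b_def by blast
qed

end
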